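(* Let $G$ be a simple connected graph with maximum degree $\Delta$ and minimum degree $\delta$. Then $$DSO(G)\geq \frac{M_1(G)-2\,ISI(G)+\delta\Delta\, H(G)}{\sqrt{2}(\Delta+\delta)}.$$ Equality holds if and only if $G$ is a regular graph.
   Context: For a simple graph $G=(V,E)$, $d_u$ denotes the degree of vertex $u$. The Diminished Sombor index is $DSO(G)=\sum_{uv\in E}\frac{\sqrt{d_u^2+d_v^2}}{d_u+d_v}$. The first Zagreb index is $M_1(G)=\sum_{uv\in E}(d_u+d_v)$, the inverse sum indeg index is $ISI(G)=\sum_{uv\in E}\frac{d_ud_v}{d_u+d_v}$, and the harmonic index is $H(G)=\sum_{uv\in E}\frac{2}{d_u+d_v}$. *)

theory Defs
  imports Complex_Main
begin

text \<open>An edge is the two-element set of its endpoints. The vertex set of a graph is finite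
  and nonempty, so that the minimum and maximum degree exist.\<close>

locale simple_graph =
  fixes V :: "'a set" and E :: "'a set set"
  assumes finite_vertices: "finite V"
    and vertices_nonempty: "V \<noteq> {}"
    and edges_subset: "e \<in> E \<Longrightarrow> e \<subseteq> V"
    and edges_card: "e \<in> E \<Longrightarrow> card e = 2"

definition connected_graph :: "'a set \<Rightarrow> 'a set set \<Rightarrow> bool" where
  "connected_graph V E \<longleftrightarrow> (\<forall>u\<in>V. \<forall>v\<in>V. (u, v) \<in> {(x, y). {x, y} \<in> E}\<^sup>*)"

definition degree :: "'a set set \<Rightarrow> 'a \<Rightarrow> nat" where
  "degree E v = card {e \<in> E. v \<in> e}"

definition max_degree :: "'a set \<Rightarrow> 'a set set \<Rightarrow> nat" where
  "max_degree V E = Max (degree E ` V)"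

definition min_degree :: "'a set \<Rightarrow> 'a set set \<Rightarrow> nat" where
  "min_degree V E = Min (degree E ` V)"

definition regular_graph :: "'a set \<Rightarrow> 'a set set \<Rightarrow> bool" where
  "regular_graph V E \<longleftrightarrow> (\<exists>k. \<forall>v\<in>V. degree E v = k)"

text \<open>In the indices below, a sum or product over the two endpoints \<open>w \<in> e\<close> of an edge
  \<open>e = {u, v}\<close> stands for the corresponding symmetric expression in \<open>u\<close> and \<open>v\<close>, for example
  \<open>(\<Sum>w\<in>e. real (degree E w)) = d\<^sub>u + d\<^sub>v\<close>.\<close>

definition diminished_sombor_index :: "'a set set \<Rightarrow> real" where
  "diminished_sombor_index E =
    (\<Sum>e\<in>E. sqrt (\<Sum>w\<in>e. (real (degree E w))\<^sup>2) / (\<Sum>w\<in>e. real (degree E w)))"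

definition first_zagreb_index :: "'a set set \<Rightarrow> real" where
  "first_zagreb_index E = (\<Sum>e\<in>E. \<Sum>w\<in>e. real (degree E w))"

definition inverse_sum_indeg_index :: "'a set set \<Rightarrow> real" where
  "inverse_sum_indeg_index E =
    (\<Sum>e\<in>E. (\<Prod>w\<in>e. real (degree E w)) / (\<Sum>w\<in>e. real (degree E w)))"

definition harmonic_index :: "'a set set \<Rightarrow> real" where
  "harmonic_index E = (\<Sum>e\<in>E. 2 / (\<Sum>w\<in>e. real (degree E w)))"

end

theory Submission imports Defs begin

text \<open>For an edge \<open>uv\<close> let \<open>x\<close> be the quadratic mean of \<open>d\<^sub>u\<close> and \<open>d\<^sub>v\<close>. The contribution of
  \<open>uv\<close> to the difference of the two sides is a positive multiple of \<open>(x - \<delta>) (\<Delta> - x)\<close>, and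
  \<open>\<delta> \<le> x \<le> \<Delta>\<close>, which gives the inequality. If \<open>x\<close> equals \<open>\<delta>\<close> or \<open>\<Delta>\<close>, then \<open>d\<^sub>u = d\<^sub>v\<close>; hence
  equality makes the degree constant along edges, and so constant by connectedness.\<close>

definition quadratic_mean :: "real \<Rightarrow> real \<Rightarrow> real" where
  "quadratic_mean a b = sqrt ((a\<^sup>2 + b\<^sup>2) / 2)"

lemma quadratic_mean_ge:
  fixes m a b :: real
  assumes "0 \<le> m" "m \<le> a" "m \<le> b"
  shows "m \<le> quadratic_mean a b"
proof -
  have "m\<^sup>2 + m\<^sup>2 \<le> a\<^sup>2 + b\<^sup>2"
    using assms by (intro add_mono power_mono)
  then show ?thesis
    unfolding quadratic_mean_def by (intro real_le_rsqrt) simp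
qed

lemma quadratic_mean_le:
  fixes a b M :: real
  assumes "0 \<le> a" "0 \<le> b" "a \<le> M" "b \<le> M"
  shows "quadratic_mean a b \<le> M"
proof -
  have "a\<^sup>2 + b\<^sup>2 \<le> M\<^sup>2 + M\<^sup>2"
    using assms by (intro add_mono power_mono)
  then have "(a\<^sup>2 + b\<^sup>2) / 2 \<le> M\<^sup>2" by simp
  then show ?thesis
    unfolding quadratic_mean_def using assms by (intro real_le_lsqrt) simp_all
qed

lemma quadratic_mean_same: "0 \<le> a \<Longrightarrow> quadratic_mean a a = a"
  by (simp add: quadratic_mean_def)

text \<open>Two squares that are each at least \<open>m\<^sup>2\<close> and average to
  \<open>m\<^sup>2\<close> both equal it, and nonnegativity allows the squares to be dropped. The
  upper case is dual.\<close>

lemma quadratic_mean_eq_lower: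
  fixes m a b :: real
  assumes "0 \<le> m" "m \<le> a" "m \<le> b" "quadratic_mean a b = m"
  shows "a = m \<and> b = m"
proof -
  have "(a\<^sup>2 + b\<^sup>2) / 2 = m\<^sup>2"
    using assms(4) unfolding quadratic_mean_def by (auto simp: real_sqrt_pow2)
  moreover have "m\<^sup>2 \<le> a\<^sup>2" "m\<^sup>2 \<le> b\<^sup>2"
    using assms by (auto intro: power_mono)
  ultimately have "a\<^sup>2 = m\<^sup>2" "b\<^sup>2 = m\<^sup>2" by auto
  with assms show ?thesis by (auto simp: power2_eq_iff_nonneg)
qed

lemma quadratic_mean_eq_upper:
  fixes a b M :: real
  assumes "0 \<le> a" "0 \<le> b" "a \<le> M" "b \<le> M" "quadratic_mean a b = M"
  shows "a = M \<and> b = M"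
proof -
  have "(a\<^sup>2 + b\<^sup>2) / 2 = M\<^sup>2"
    using assms(5) unfolding quadratic_mean_def by (auto simp: real_sqrt_pow2)
  moreover have "a\<^sup>2 \<le> M\<^sup>2" "b\<^sup>2 \<le> M\<^sup>2"
    using assms by (auto intro: power_mono)
  ultimately have "a\<^sup>2 = M\<^sup>2" "b\<^sup>2 = M\<^sup>2" by auto
  with assms show ?thesis by (auto simp: power2_eq_iff_nonneg)
qed

text \<open>With \<open>x\<close> the quadratic mean and \<open>s = a + b\<close>, the identity
  \<open>2 * (a * b) = s\<^sup>2 - 2 * x\<^sup>2\<close> eliminates the product, so both fractions
  depend on \<open>a\<close> and \<open>b\<close> only through \<open>x\<close> and
  \<open>s\<close>. Over the common denominator the numerator is quadratic in \<open>x\<close> with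
  roots \<open>m\<close> and \<open>M\<close>. Being an identity, it serves the inequality and the
  equality case alike.\<close>

lemma edge_gap:
  fixes a b m M :: real
  assumes "0 < a + b" "0 < M + m"
  shows "sqrt (a\<^sup>2 + b\<^sup>2) / (a + b)
      - (a + b - 2 * (a * b / (a + b)) + m * M * (2 / (a + b))) / (sqrt 2 * (M + m))
    = 2 * ((quadratic_mean a b - m) * (M - quadratic_mean a b)) / (sqrt 2 * (M + m) * (a + b))"
proof -
  define x s D where "x = quadratic_mean a b" and "s = a + b" and "D = M + m"
  have s: "s > 0" and D: "D > 0" using assms by (simp_all add: s_def D_def)
  have r: "sqrt (a\<^sup>2 + b\<^sup>2) = sqrt 2 * x"
    by (simp add: x_def quadratic_mean_def real_sqrt_divide)
  have xx: "2 * x\<^sup>2 = s\<^sup>2 - 2 * (a * b)"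
    by (simp add: x_def s_def quadratic_mean_def power2_sum)
  have "s - 2 * (a * b / s) + m * M * (2 / s) = (s\<^sup>2 - 2 * (a * b) + 2 * (m * M)) / s"
    using s by (simp add: field_simps power2_eq_square)
  also have "\<dots> = (2 * x\<^sup>2 + 2 * (m * M)) / s"
    by (simp only: xx)
  finally have "(s - 2 * (a * b / s) + m * M * (2 / s)) / (sqrt 2 * D)
      = (2 * x\<^sup>2 + 2 * (m * M)) / (sqrt 2 * D * s)"
    by (simp add: mult_ac)
  moreover have "sqrt 2 * x / s = 2 * x * D / (sqrt 2 * D * s)"
    using s D by (simp add: field_simps)
  ultimately have "sqrt 2 * x / s - (s - 2 * (a * b / s) + m * M * (2 / s)) / (sqrt 2 * D)
      = (2 * x * D - (2 * x\<^sup>2 + 2 * (m * M))) / (sqrt 2 * D * s)"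
    by (simp add: diff_divide_distrib)
  also have "2 * x * D - (2 * x\<^sup>2 + 2 * (m * M)) = 2 * ((x - m) * (M - x))"
    by (simp add: D_def algebra_simps power2_eq_square)
  finally show ?thesis
    by (simp add: r flip: x_def s_def D_def)
qed

lemma edge_gap_nonneg:
  fixes a b m M :: real
  assumes "0 \<le> m" "m \<le> a" "m \<le> b" "a \<le> M" "b \<le> M" "0 < a + b"
  shows "(a + b - 2 * (a * b / (a + b)) + m * M * (2 / (a + b))) / (sqrt 2 * (M + m))
    \<le> sqrt (a\<^sup>2 + b\<^sup>2) / (a + b)"
proof -
  have "0 \<le> (quadratic_mean a b - m) * (M - quadratic_mean a b)"
    using quadratic_mean_ge[of m a b] quadratic_mean_le[of a b M] assms by simp
  then have "0 \<le> 2 * ((quadratic_mean a b - m) * (M - quadratic_mean a b))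
      / (sqrt 2 * (M + m) * (a + b))"
    using assms by simp
  \<comment> \<open>A positive \<open>a + b\<close> with both summands at most \<open>M\<close>
    forces \<open>M > 0\<close>.\<close>
  moreover have "0 < M + m" using assms by linarith
  ultimately show ?thesis
    using edge_gap[of a b M m] assms(6) by linarith
qed

lemma edge_gap_eq_iff:
  fixes a b m M :: real
  assumes "0 \<le> m" "m \<le> a" "m \<le> b" "a \<le> M" "b \<le> M" "0 < a + b"
  shows "sqrt (a\<^sup>2 + b\<^sup>2) / (a + b)
      = (a + b - 2 * (a * b / (a + b)) + m * M * (2 / (a + b))) / (sqrt 2 * (M + m))
    \<longleftrightarrow> a = b \<and> (a = m \<or> a = M)"
proof -
  have "0 < M + m" using assms by linarith
  with edge_gap[of a b M m] assms(6)
  have "sqrt (a\<^sup>2 + b\<^sup>2) / (a + b)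
      = (a + b - 2 * (a * b / (a + b)) + m * M * (2 / (a + b))) / (sqrt 2 * (M + m))
    \<longleftrightarrow> quadratic_mean a b = m \<or> quadratic_mean a b = M"
    \<comment> \<open>Equality becomes the vanishing of the difference given by
      \<open>edge_gap\<close>; its denominator is nonzero, so one of the two factors is 0.\<close>
    by (subst right_minus_eq[symmetric]) auto
  also have "\<dots> \<longleftrightarrow> a = b \<and> (a = m \<or> a = M)"
    using quadratic_mean_eq_lower[of m a b] quadratic_mean_eq_upper[of a b M]
      quadratic_mean_same[of a] assms by auto
  finally show ?thesis .
qed

context simple_graph
begin

lemma finite_edges: "finite E"
  by (rule finite_subset[of _ "Pow V"]) (use edges_subset finite_vertices in auto)

lemma degree_pos: "e \<in> E \<Longrightarrow> v \<in> e \<Longrightarrow> 0 < degree E v"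
  using finite_edges by (auto simp: degree_def card_gt_0_iff)

lemma min_degree_le: "v \<in> V \<Longrightarrow> min_degree V E \<le> degree E v"
  using finite_vertices by (simp add: min_degree_def)

lemma max_degree_ge: "v \<in> V \<Longrightarrow> degree E v \<le> max_degree V E"
  using finite_vertices by (simp add: max_degree_def)

lemma edge_endpoints:
  assumes "e \<in> E"
  obtains u v where "e = {u, v}" "u \<noteq> v" "u \<in> V" "v \<in> V"
  using edges_card[OF assms] edges_subset[OF assms] by (auto simp: card_2_iff)

lemma regular_degree:
  assumes "regular_graph V E" "v \<in> V"
  shows "degree E v = min_degree V E"
proof -
  have "degree E ` V = {degree E v}"
    using assms by (auto simp: regular_graph_def)
  then show ?thesis by (simp add: min_degree_def)
qed

text \<open>The degree is carried along a path by induction; the degree of any chosen vertex then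
  serves as the common value.\<close>

lemma regular_if_degree_eq_on_edges:
  assumes "connected_graph V E" and "\<And>u v. {u, v} \<in> E \<Longrightarrow> degree E u = degree E v"
  shows "regular_graph V E"
proof -
  have "degree E u = degree E v" if "(u, v) \<in> {(x, y). {x, y} \<in> E}\<^sup>*" for u v
    using that by (induction rule: rtrancl_induct) (auto dest: assms(2))
  then show ?thesis
    using assms(1) vertices_nonempty unfolding connected_graph_def regular_graph_def by blast
qed

end

theorem theorem3p7:
  fixes V :: "'a set" and E :: "'a set set" and \<Delta> \<delta> :: nat
  assumes "simple_graph V E"
    and "connected_graph V E"
    and "\<Delta> = max_degree V E"
    and "\<delta> = min_degree V E"
  shows "diminished_sombor_index E \<ge>
           (first_zagreb_index E - 2 * inverse_sum_indeg_index E
              + real \<delta> * real \<Delta> * harmonic_index E) / (sqrt 2 * (real \<Delta> + real \<delta>))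
         \<and> (diminished_sombor_index E =
             (first_zagreb_index E - 2 * inverse_sum_indeg_index E
                + real \<delta> * real \<Delta> * harmonic_index E) / (sqrt 2 * (real \<Delta> + real \<delta>))
            \<longleftrightarrow> regular_graph V E)"
proof -
  interpret simple_graph V E by fact
  define L where "L e = sqrt (\<Sum>w\<in>e. (real (degree E w))\<^sup>2) / (\<Sum>w\<in>e. real (degree E w))" for e
  define R where "R e = ((\<Sum>w\<in>e. real (degree E w))
      - 2 * ((\<Prod>w\<in>e. real (degree E w)) / (\<Sum>w\<in>e. real (degree E w)))
      + real \<delta> * real \<Delta> * (2 / (\<Sum>w\<in>e. real (degree E w)))) / (sqrt 2 * (real \<Delta> + real \<delta>))" for e
  have L: "diminished_sombor_index E = sum L E"
    by (simp add: diminished_sombor_index_def L_def)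
  \<comment> \<open>This also covers the one-vertex graph, where \<Delta> + \<delta> = 0: division
    by 0 yields 0, and the sums over the empty \<open>E\<close> are 0 as well.\<close>
  have R: "(first_zagreb_index E - 2 * inverse_sum_indeg_index E
      + real \<delta> * real \<Delta> * harmonic_index E) / (sqrt 2 * (real \<Delta> + real \<delta>)) = sum R E"
    unfolding first_zagreb_index_def inverse_sum_indeg_index_def harmonic_index_def R_def
    by (simp only: sum_distrib_left flip: sum.distrib sum_subtractf sum_divide_distrib)
  have bounds: "real \<delta> \<le> real (degree E u)" "real (degree E u) \<le> real \<Delta>" if "u \<in> V" for u
    using min_degree_le[OF that] max_degree_ge[OF that] assms(3,4) by simp_all
  \<comment> \<open>The condition \<open>u \<noteq> v\<close> makes the sums and products over
    \<open>{u, v}\<close> have two separate terms.\<close>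
  have edge: "R {u, v} \<le> L {u, v} \<and> (L {u, v} = R {u, v} \<longleftrightarrow>
      degree E u = degree E v \<and> (degree E u = \<delta> \<or> degree E u = \<Delta>))"
    if e: "{u, v} \<in> E" and "u \<noteq> v" for u v
  proof -
    have V: "u \<in> V" "v \<in> V" using edges_subset[OF e] by auto
    have "0 < real (degree E u) + real (degree E v)"
      using degree_pos[OF e, of u] by simp
    \<comment> \<open>Listed in the order of the hypotheses shared by the two edge lemmas, with
      \<delta> as \<open>m\<close> and \<Delta> as \<open>M\<close>.\<close>
    note * = of_nat_0_le_iff bounds(1)[OF V(1)] bounds(1)[OF V(2)]
      bounds(2)[OF V(1)] bounds(2)[OF V(2)] this
    show ?thesis
      using edge_gap_nonneg[OF *] edge_gap_eq_iff[OF *] \<open>u \<noteq> v\<close> by (simp add: L_def R_def)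
  qed
  have le: "R e \<le> L e" if "e \<in> E" for e
    using that edge by (metis edge_endpoints)
  have "sum R E \<le> sum L E"
    using le by (rule sum_mono)
  moreover have "sum L E = sum R E \<longleftrightarrow> regular_graph V E"
  proof
    assume eq: "sum L E = sum R E"
    have "L e = R e" if "e \<in> E" for e
      \<comment> \<open>Finite sums of termwise ordered families agree only if every term
        agrees.\<close>
      using sum_mono_inv[OF eq[symmetric] le that finite_edges] by simp
    then have "degree E u = degree E v" if "{u, v} \<in> E" for u v
      using edge[OF that] that by (cases "u = v") auto
    with assms(2) show "regular_graph V E"
      by (rule regular_if_degree_eq_on_edges)
  next
    assume reg: "regular_graph V E"
    have "L e = R e" if e: "e \<in> E" for e
    proof -
      obtain u v where "e = {u, v}" "u \<noteq> v" "u \<in> V" "v \<in> V"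
        using edge_endpoints[OF e] .
      \<comment> \<open>Regularity makes both endpoint degrees equal to \<delta>, the first
        alternative in \<open>edge\<close>.\<close>
      with edge[of u v] e regular_degree[OF reg] assms(4) show ?thesis by simp
    qed
    then show "sum L E = sum R E" by (rule sum.cong[OF refl])
  qed
  ultimately show ?thesis by (simp only: L R simp_thms)
qed

end
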